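(* Fix any integer $d^\star\ge2$ and any $\varepsilon\in(0,1/4)$. There exist an ambient dimension $d\ge d^\star$, a nondegenerate polytope $\mathcal{X}=\{x\in\mathbb{R}^d: Ax=b,\ x\ge0\}$, a convex uncertainty set $\mathcal{C}\subseteq\mathbb{R}^d$ with $\dim\operatorname{dir}(\mathcal{X}^\star(\mathcal{C}))=d^\star$, and a distribution $P_c$ supported on $\mathcal{C}$ such that the following holds. If $\mathcal{D}_n$ is the output dataset of the cumulative algorithm (Algorithm 2, described in the context) on $n$ i.i.d. samples from $P_c$ and $n\le\frac{d^\star-1}{8\varepsilon}$, then $$\mathbb{P}\bigl(R(\mathcal{D}_n)>\varepsilon\bigr)\ \ge\ \frac12 .$$
   Context: $A\in\mathbb{R}^{m\times d}$ has full row rank and $\mathcal{X}$ is nonempty and bounded. Nondegenerate: every extreme point of $\mathcal{X}$ has exactly $m$ strictly positive components. $\mathcal{X}^\angle$ is the set of extreme points, $\mathcal{X}^\star(c):=\operatorname{argmin}_{x\in\mathcal{X}}c^\top x$, $\mathcal{X}^\star(\mathcal{C}):=\bigcup_{c\in\mathcal{C}}(\mathcal{X}^\star(c)\cap\mathcal{X}^\angle)$, $\operatorname{dir}(\mathcal{X}^\star(\mathcal{C})):=\operatorname{span}\{x-x':x,x'\in\mathcal{X}^\star(\mathcal{C})\}$. A dataset is a finite set $\mathcal{D}=\{q_1,\dots,q_l\}\subset\mathbb{R}^d$; $s(c;\mathcal{D}):=(q_1^\top c,\dots,q_l^\top c)$; $\mathcal{C}(\mathcal{D},s):=\{c'\in\mathcal{C}: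 q_i^\top c'=s_i\ \forall i\}$. $\mathcal{D}$ is pointwise sufficient at $c\in\mathcal{C}$ if there is $x^\star\in\mathcal{X}$ with $x^\star\in\mathcal{X}^\star(c')$ for all $c'\in\mathcal{C}(\mathcal{D},s(c;\mathcal{D}))$. The risk is $R(\mathcal{D}):=\mathbb{P}_{c\sim P_c}[\mathcal{D}\text{ is not pointwise sufficient at }c]$. For a basis $B\subseteq\{1,\dots,d\}$, $|B|=m$ ($A_B$ invertible), with complement $N$, $x(B)$ has $x_N(B)=0$, $x_B(B)=A_B^{-1}b$. For $j\in N$, $\delta(B,j)\in\mathbb{R}^d$ has $\delta_N(B,j)=e_j$, $\delta_B(B,j)=-A_B^{-1}A_j$, $A_j$ the $j$th column of $A$. Algorithm 1. Input: $(A,b)$, $\mathcal{C}$, $c\in\mathcal{C}$, and an initial finite dataset $\mathcal{D}_{\mathrm{init}}\subset\mathbb{R}^d$. Set $\mathcal{D}\leftarrow\mathcal{D}_{\mathrm{init}}$. Repeat: 1. Let $k=|\mathcal{D}|$, $\mathcal{C}_k:=\mathcal{C}(\mathcal{D},s(c;\mathcal{D}))$, $c^{\mathrm{in}}:=c$. 2. Solve $\min\{(c^{\mathrm{in}})^\top x: x\in\mathcal{X}\}$, obtaining an optimal feasible basis $B$ with nonbasis $N$. 3. For each $j\in N$ let $\delta_j:=\delta(B,j)$, $m_j:=\min_{c'\in\mathcal{C}_k}(c')^\top\delta_j$, and let $c^{\mathrm{out}}_j$ be a minimizer (if the infimum is not attained, $m_j$ is the infimum and, when $m_j<0$, $c_j^{\mathrm{out}}$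 is a point of $\mathcal{C}_k$ with $(c_j^{\mathrm{out}})^\top\delta_j<0$). 4. Let $j_0\in\operatorname{argmin}_{j\in N}m_j$, $m_{\min}:=m_{j_0}$, $c^{\mathrm{out}}:=c^{\mathrm{out}}_{j_0}$. 5. If $m_{\min}\ge0$, return $\mathcal{D}$ and stop. 6. Otherwise, for each $j\in N$ with $(c^{\mathrm{out}})^\top\delta_j<0$ set $\alpha_j:=\frac{(c^{\mathrm{in}})^\top\delta_j}{(c^{\mathrm{in}})^\top\delta_j-(c^{\mathrm{out}})^\top\delta_j}\in[0,1)$, pick $j^\star\in\operatorname{argmin}_j\alpha_j$, set $q_{k+1}:=\delta_{j^\star}$ and $\mathcal{D}\leftarrow\mathcal{D}\cup\{q_{k+1}\}$. All non-unique choices are resolved by a fixed deterministic rule. Algorithm 2 (cumulative). Input: $\mathcal{C}$, $(A,b)$, samples $c_1,\dots,c_n\in\mathcal{C}$. Set $\mathcal{D}_0=\emptyset$. For $i=1,\dots,n$: run Algorithm 1 on $c_i$ with $\mathcal{D}_{\mathrm{init}}=\mathcal{D}_{i-1}$ and let $\mathcal{D}_i$ be the returned dataset. Return $\mathcal{D}_n$ (together with the set $T$ of indices $i$ with $\mathcal{D}_i\ne\mathcal{D}_{i-1}$). *)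

theory Defs
  imports
    "HOL-Probability.Probability"
    "HOL-Library.While_Combinator"
    "Jordan_Normal_Form.Gauss_Jordan_Elimination"
    "Jordan_Normal_Form.DL_Rank"
    "Jordan_Normal_Form.DL_Submatrix"
begin

unbundle no inner_syntax
unbundle no vec_syntax

type_synonym rvec = "real Matrix.vec"
type_synonym rmat = "real Matrix.mat"

text \<open>Vectors of \<open>\<real>\<^sup>d\<close> are the elements of \<open>carrier_vec d\<close>, so that \<open>d\<close> can be quantified over.
  Coordinates are numbered from 0.\<close>

definition extreme_points :: "rvec set \<Rightarrow> rvec set" where
  "extreme_points S = {x \<in> S. \<not> (\<exists>u\<in>S. \<exists>v\<in>S. \<exists>t. u \<noteq> v \<and> 0 < t \<and> t < 1 \<and>
     x = (1 - t) \<cdot>\<^sub>v u + t \<cdot>\<^sub>v v)}"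

definition convex_vecs :: "rvec set \<Rightarrow> bool" where
  "convex_vecs S \<longleftrightarrow> (\<forall>u\<in>S. \<forall>v\<in>S. \<forall>t. 0 \<le> t \<and> t \<le> 1 \<longrightarrow> (1 - t) \<cdot>\<^sub>v u + t \<cdot>\<^sub>v v \<in> S)"

definition bounded_vecs :: "rvec set \<Rightarrow> bool" where
  "bounded_vecs S \<longleftrightarrow> (\<exists>M. \<forall>x\<in>S. \<forall>i<dim_vec x. \<bar>x $ i\<bar> \<le> M)"

definition span_dim :: "nat \<Rightarrow> rvec set \<Rightarrow> nat" where
  "span_dim d S = vectorspace.dim class_ring
     (module.span_vs class_ring (module_vec TYPE(real) d) S)"

text \<open>\<open>vec_space.rank\<close> is the column rank, hence the transpose.\<close>

definition full_row_rank :: "rmat \<Rightarrow> bool" where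
  "full_row_rank A \<longleftrightarrow> vec_space.rank (dim_col A) (transpose_mat A) = dim_row A"

definition std_polytope :: "rmat \<Rightarrow> rvec \<Rightarrow> rvec set" where
  "std_polytope A b = {x \<in> carrier_vec (dim_col A). A *\<^sub>v x = b \<and> 0\<^sub>v (dim_col A) \<le> x}"

definition nondegenerate :: "rmat \<Rightarrow> rvec \<Rightarrow> bool" where
  "nondegenerate A b \<longleftrightarrow> (\<forall>x \<in> extreme_points (std_polytope A b).
     card {i. i < dim_col A \<and> 0 < x $ i} = dim_row A)"

definition argmin_set :: "rmat \<Rightarrow> rvec \<Rightarrow> rvec \<Rightarrow> rvec set" where
  "argmin_set A b c = {x. is_arg_min (\<lambda>x. c \<bullet> x) (\<lambda>x. x \<in> std_polytope A b) x}"

definition opt_vertices :: "rmat \<Rightarrow> rvec \<Rightarrow> rvec set \<Rightarrow> rvec set" where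
  "opt_vertices A b C = (\<Union>c\<in>C. argmin_set A b c \<inter> extreme_points (std_polytope A b))"

definition dir_dim :: "rmat \<Rightarrow> rvec \<Rightarrow> rvec set \<Rightarrow> nat" where
  "dir_dim A b C = span_dim (dim_col A)
     {x - x' | x x'. x \<in> opt_vertices A b C \<and> x' \<in> opt_vertices A b C}"

definition observations :: "rvec \<Rightarrow> rvec \<Rightarrow> real" where
  "observations c = (\<lambda>q. q \<bullet> c)"

definition consistent :: "rvec set \<Rightarrow> rvec set \<Rightarrow> (rvec \<Rightarrow> real) \<Rightarrow> rvec set" where
  "consistent C D s = {c' \<in> C. \<forall>q\<in>D. q \<bullet> c' = s q}"

definition pointwise_sufficient :: "rmat \<Rightarrow> rvec \<Rightarrow> rvec set \<Rightarrow> rvec set \<Rightarrow> rvec \<Rightarrow> bool" where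
  "pointwise_sufficient A b C D c \<longleftrightarrow>
     (\<exists>x \<in> std_polytope A b. \<forall>c' \<in> consistent C D (observations c). x \<in> argmin_set A b c')"

text \<open>The Borel sigma-algebra of \<open>\<real>\<^sup>d\<close>.\<close>

definition vec_borel :: "nat \<Rightarrow> rvec measure" where
  "vec_borel d = vimage_algebra (carrier_vec d) (\<lambda>v. \<lambda>i\<in>{..<d}. v $ i) (\<Pi>\<^sub>M i\<in>{..<d}. borel)"

text \<open>\<open>C\<close> need not be a Borel set, so membership in it is required almost everywhere.\<close>

definition distribution_on :: "nat \<Rightarrow> rvec set \<Rightarrow> rvec measure \<Rightarrow> bool" where
  "distribution_on d C P \<longleftrightarrow>
     prob_space P \<and> sets P = sets (vec_borel d) \<and> (AE c in P. c \<in> C)"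

text \<open>Probabilities are taken in the completed measure, because the events of interest involve
  arbitrary convex sets and arbitrary selection rules. A set outside the completed sigma-algebra
  has \<open>measure\<close> 0, so a positive lower bound entails measurability.\<close>

definition risk :: "rmat \<Rightarrow> rvec \<Rightarrow> rvec set \<Rightarrow> rvec measure \<Rightarrow> rvec set \<Rightarrow> real" where
  "risk A b C P D = measure (completion P) {c \<in> C. \<not> pointwise_sufficient A b C D c}"

definition is_basis :: "rmat \<Rightarrow> nat set \<Rightarrow> bool" where
  "is_basis A B \<longleftrightarrow> B \<subseteq> {..<dim_col A} \<and> card B = dim_row A \<and>
     invertible_mat (submatrix A UNIV B)"

definition basis_inverse :: "rmat \<Rightarrow> nat set \<Rightarrow> rmat" where
  "basis_inverse A B = the (mat_inverse (submatrix A UNIV B))"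

text \<open>The columns of \<open>submatrix A UNIV B\<close> are in increasing order of the indices in \<open>B\<close>, so index
  \<open>i \<in> B\<close> has position \<open>card {k \<in> B. k < i}\<close>.\<close>

definition pos_in :: "nat set \<Rightarrow> nat \<Rightarrow> nat" where
  "pos_in B i = card {k \<in> B. k < i}"

definition basic_point :: "rmat \<Rightarrow> rvec \<Rightarrow> nat set \<Rightarrow> rvec" where
  "basic_point A b B = Matrix.vec (dim_col A) (\<lambda>i.
     if i \<in> B then (basis_inverse A B *\<^sub>v b) $ pos_in B i else 0)"

definition edge_dir :: "rmat \<Rightarrow> nat set \<Rightarrow> nat \<Rightarrow> rvec" where
  "edge_dir A B j = Matrix.vec (dim_col A) (\<lambda>i.
     if i \<in> B then - ((basis_inverse A B *\<^sub>v Matrix.col A j) $ pos_in B i)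
     else if i = j then 1 else 0)"

definition nonbasis :: "rmat \<Rightarrow> nat set \<Rightarrow> nat set" where
  "nonbasis A B = {..<dim_col A} - B"

text \<open>The non-unique choices of one iteration of the pointwise algorithm: the optimal basis, the
  points \<open>c\<^sup>o\<^sup>u\<^sup>t\<^sub>j\<close>, the index \<open>j\<^sub>0\<close> and the index \<open>j\<^sup>\<star>\<close>. A deterministic selection rule (for the instance
  \<open>(A, b, C)\<close>) computes them from the cost vector \<open>c\<close> and the current dataset \<open>D\<close>, which together
  are the whole state of the algorithm.\<close>

record choice =
  ch_basis :: "nat set"
  ch_out :: "nat \<Rightarrow> rvec"
  ch_j0 :: nat
  ch_jstar :: nat

type_synonym rule = "rvec \<Rightarrow> rvec set \<Rightarrow> choice"

text \<open>\<open>m\<^sub>j\<close> for \<open>\<delta> = \<delta>\<^sub>j\<close>; it may be \<open>-\<infinity>\<close>.\<close>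

definition min_reduced_cost :: "rvec set \<Rightarrow> rvec \<Rightarrow> ereal" where
  "min_reduced_cost Ck \<delta> = (INF c'\<in>Ck. ereal (c' \<bullet> \<delta>))"

definition valid_out :: "rvec set \<Rightarrow> rvec \<Rightarrow> rvec \<Rightarrow> bool" where
  "valid_out Ck \<delta> co \<longleftrightarrow>
     (if \<exists>c'. is_arg_min (\<lambda>c'. c' \<bullet> \<delta>) (\<lambda>c'. c' \<in> Ck) c'
      then is_arg_min (\<lambda>c'. c' \<bullet> \<delta>) (\<lambda>c'. c' \<in> Ck) co
      else min_reduced_cost Ck \<delta> < 0 \<longrightarrow> co \<in> Ck \<and> co \<bullet> \<delta> < 0)"

definition step_ratio :: "rvec \<Rightarrow> rvec \<Rightarrow> rvec \<Rightarrow> real" where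
  "step_ratio cin cout \<delta> = (cin \<bullet> \<delta>) / (cin \<bullet> \<delta> - cout \<bullet> \<delta>)"

text \<open>The set \<open>nonbasis A B\<close> is empty if \<open>A\<close> is square; then there is no \<open>j\<^sub>0\<close> and the algorithm
  stops.\<close>

definition improvable :: "rmat \<Rightarrow> rvec set \<Rightarrow> rvec \<Rightarrow> rvec set \<Rightarrow> choice \<Rightarrow> bool" where
  "improvable A C c D ch \<longleftrightarrow> nonbasis A (ch_basis ch) \<noteq> {} \<and>
     min_reduced_cost (consistent C D (observations c)) (edge_dir A (ch_basis ch) (ch_j0 ch)) < 0"

definition valid_choice :: "rmat \<Rightarrow> rvec \<Rightarrow> rvec set \<Rightarrow> rvec \<Rightarrow> rvec set \<Rightarrow> choice \<Rightarrow> bool" where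
  "valid_choice A b C c D ch \<longleftrightarrow>
    (let B = ch_basis ch; N = nonbasis A B; \<delta> = edge_dir A B;
         Ck = consistent C D (observations c); cout = ch_out ch (ch_j0 ch)
     in is_basis A B \<and> basic_point A b B \<in> argmin_set A b c \<and>
        (\<forall>j\<in>N. valid_out Ck (\<delta> j) (ch_out ch j)) \<and>
        (N \<noteq> {} \<longrightarrow> is_arg_min (\<lambda>j. min_reduced_cost Ck (\<delta> j)) (\<lambda>j. j \<in> N) (ch_j0 ch)) \<and>
        (improvable A C c D ch \<longrightarrow>
           is_arg_min (\<lambda>j. step_ratio c cout (\<delta> j)) (\<lambda>j. j \<in> N \<and> cout \<bullet> \<delta> j < 0) (ch_jstar ch)))"

definition valid_rule :: "rmat \<Rightarrow> rvec \<Rightarrow> rvec set \<Rightarrow> rule \<Rightarrow> bool" where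
  "valid_rule A b C \<sigma> \<longleftrightarrow>
     (\<forall>c\<in>C. \<forall>D. finite D \<and> D \<subseteq> carrier_vec (dim_col A) \<longrightarrow> valid_choice A b C c D (\<sigma> c D))"

text \<open>For \<open>c \<in> C\<close>, a valid rule and a nondegenerate polytope the loop terminates: the query added is
  not orthogonal to \<open>c\<^sup>o\<^sup>u\<^sup>t - c\<close>, whereas the previous ones are, so it is not in their span.\<close>

definition pointwise_alg :: "rmat \<Rightarrow> rvec set \<Rightarrow> rule \<Rightarrow> rvec \<Rightarrow> rvec set \<Rightarrow> rvec set" where
  "pointwise_alg A C \<sigma> c Dinit =
     while (\<lambda>D. improvable A C c D (\<sigma> c D))
       (\<lambda>D. D \<union> {edge_dir A (ch_basis (\<sigma> c D)) (ch_jstar (\<sigma> c D))})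
       Dinit"

text \<open>The dataset after the first \<open>i\<close> samples \<open>cs 0, \<dots>, cs (i - 1)\<close>.\<close>

primrec cumulative_alg :: "rmat \<Rightarrow> rvec set \<Rightarrow> rule \<Rightarrow> (nat \<Rightarrow> rvec) \<Rightarrow> nat \<Rightarrow> rvec set" where
  "cumulative_alg A C \<sigma> cs 0 = {}"
| "cumulative_alg A C \<sigma> cs (Suc i) = pointwise_alg A C \<sigma> (cs i) (cumulative_alg A C \<sigma> cs i)"

end

theory Submission
  imports Defs
begin

text \<open>The lower bound is a coupon-collector argument. Write \<open>s\<close> for the required dimension. The polytope
  is the simplex in \<open>\<real>\<^bsup>s+1\<^esup>\<close>, whose bases are single indices and whose edge directions at vertex 0 are
  the vectors \<open>e\<^sub>j - e\<^sub>0\<close>. All costs have \<open>c\<^sub>0 = 0\<close>, so that the query \<open>e\<^sub>j - e\<^sub>0\<close> reads off \<open>c\<^sub>j\<close>. Coordinate 1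
  is a key and coordinates \<open>2, \<dots>, s\<close> are payloads: the uncertainty set is cut out by
  \<open>c\<^sub>1 \<ge> -2\<close> and \<open>c\<^sub>j \<ge> 2 \<bar>c\<^sub>1 - j\<bar> - 1\<close>. Each bound on a payload is a V-shaped function
  of the key with its tip at \<open>c\<^sub>1 = j\<close>, so for an integer key \<open>k\<close> only payload \<open>k\<close> can be negative.

  The costs in the support of the distribution have keys \<open>k = 2, \<dots>, s + 1\<close> and positive entries
  elsewhere, so they all have the unique optimal vertex \<open>e\<^sub>0\<close>. With no data, the most negative reduced
  cost is that of the key, and wherever it is attained all payloads are positive. Hence every selection
  rule queries the key first (\<open>first_query\<close>). Once the key is known to be \<open>k\<close>, only
  payload \<open>k\<close> is in doubt, so \<open>e\<^sub>k - e\<^sub>0\<close> is the only possible further query (\<open>later_query\<close>); for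
  \<open>k = s + 1\<close> there is none. Therefore the algorithm queries only those payloads whose index is
  among the keys that it has seen (\<open>cumulative_alg_queries\<close>). If key \<open>k \<le> s\<close> has not been seen, the
  dataset cannot distinguish the cost with key \<open>k\<close> and payload 1 from its twin with payload -1, whose
  optimal vertex is \<open>e\<^sub>k\<close>, and so it is insufficient there (\<open>not_sufficient\<close>).

  Give each of the \<open>s - 1\<close> rare keys \<open>2, \<dots>, s\<close> the probability \<open>2 \<epsilon> / (s - 1)\<close> and the key \<open>s + 1\<close> the
  rest. The expected number of rare draws in \<open>n \<le> (s - 1) / (8 \<epsilon>)\<close> samples is at most \<open>(s - 1) / 4\<close>, so by
  Markov's inequality fewer than \<open>(s - 1) / 2\<close> of the draws are rare with probability at least \<open>1 / 2\<close>
  (\<open>few_hits\<close>). Then more than half of the rare keys are unseen, and their mass exceeds \<open>\<epsilon>\<close>.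

  The events concerned depend on an arbitrary selection rule, but the distribution has finite support,
  so they are measurable for the completed measure (\<open>completion_finite_support\<close>).\<close>

section \<open>The standard simplex in equality form\<close>

definition simplex_mat :: "nat \<Rightarrow> rmat" where
  "simplex_mat d = Matrix.mat 1 d (\<lambda>_. 1)"

definition simplex_rhs :: rvec where
  "simplex_rhs = Matrix.vec 1 (\<lambda>_. 1)"

abbreviation std_simplex :: "nat \<Rightarrow> rvec set" where
  "std_simplex d \<equiv> std_polytope (simplex_mat d) simplex_rhs"

lemma dim_simplex_mat [simp]: "dim_row (simplex_mat d) = 1" "dim_col (simplex_mat d) = d"
  by (simp_all add: simplex_mat_def)

lemma col_simplex_mat: "j < d \<Longrightarrow> Matrix.col (simplex_mat d) j = Matrix.vec 1 (\<lambda>_. 1)"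
  by (auto simp: simplex_mat_def)

lemma mem_std_simplex:
  "x \<in> std_simplex d \<longleftrightarrow> x \<in> carrier_vec d \<and> (\<forall>i<d. 0 \<le> x $ i) \<and> (\<Sum>i<d. x $ i) = 1"
proof (cases "x \<in> carrier_vec d")
  case True
  then have "simplex_mat d *\<^sub>v x = simplex_rhs \<longleftrightarrow> (\<Sum>i<d. x $ i) = 1"
    by (auto simp: simplex_mat_def simplex_rhs_def vec_eq_iff scalar_prod_def lessThan_atLeast0)
  with True show ?thesis
    by (auto simp: std_polytope_def less_eq_vec_def)
qed (auto simp: std_polytope_def)

lemma unit_vec_mem_simplex: "i < d \<Longrightarrow> unit_vec d i \<in> std_simplex d"
  by (simp add: mem_std_simplex)

lemma bounded_simplex: "bounded_vecs (std_simplex d)"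
  unfolding bounded_vecs_def
proof (intro exI ballI allI impI)
  fix x i assume x: "x \<in> std_simplex d" and "i < dim_vec x"
  then have "i < d" "\<And>j. j < d \<Longrightarrow> 0 \<le> x $ j" "(\<Sum>j<d. x $ j) = 1"
    by (auto simp: mem_std_simplex)
  moreover from this have "x $ i \<le> (\<Sum>j<d. x $ j)"
    by (intro member_le_sum) auto
  ultimately show "\<bar>x $ i\<bar> \<le> 1" by auto
qed

lemma simplex_one_coordinate:
  assumes "x \<in> std_simplex d" "i < d" "\<And>j. j < d \<Longrightarrow> j \<noteq> i \<Longrightarrow> x $ j = 0"
  shows "x = unit_vec d i"
proof -
  have "(\<Sum>j<d. x $ j) = x $ i"
    using assms(2,3) by (subst sum.remove[of _ i]) (auto intro!: sum.neutral)
  then have "x $ i = 1" using assms(1) by (simp add: mem_std_simplex)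
  with assms show ?thesis by (intro eq_vecI) (auto simp: mem_std_simplex)
qed

lemma unit_vec_extreme:
  assumes "i < d"
  shows "unit_vec d i \<in> extreme_points (std_simplex d)"
  unfolding extreme_points_def
proof (intro CollectI conjI notI)
  show "unit_vec d i \<in> std_simplex d" using assms by (rule unit_vec_mem_simplex)
next
  assume "\<exists>u\<in>std_simplex d. \<exists>v\<in>std_simplex d. \<exists>t. u \<noteq> v \<and> 0 < t \<and> t < 1 \<and>
    (unit_vec d i :: rvec) = (1 - t) \<cdot>\<^sub>v u + t \<cdot>\<^sub>v v"
  then obtain u v t where uv: "u \<in> std_simplex d" "v \<in> std_simplex d" "u \<noteq> v" and t: "0 < t" "t < 1"
    and eq: "(unit_vec d i :: rvec) = (1 - t) \<cdot>\<^sub>v u + t \<cdot>\<^sub>v v" by blast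
  have zero: "u $ j = 0 \<and> v $ j = 0" if j: "j < d" "j \<noteq> i" for j
  proof -
    have "(unit_vec d i :: rvec) $ j = (1 - t) * u $ j + t * v $ j"
      unfolding eq using j uv by (auto simp: mem_std_simplex)
    then have "0 = (1 - t) * u $ j + t * v $ j" using j assms by simp
    moreover have "0 \<le> (1 - t) * u $ j" "0 \<le> t * v $ j"
      using t j uv by (simp_all add: mem_std_simplex)
    ultimately have "(1 - t) * u $ j = 0" "t * v $ j = 0" by linarith+
    then show ?thesis using t by simp
  qed
  have "u = unit_vec d i" "v = unit_vec d i"
    using zero assms uv by (auto intro: simplex_one_coordinate)
  with uv show False by simp
qed

text \<open>A point with two positive entries is the midpoint of the segment obtained by moving mass between
  these two entries in either direction, hence it is not extreme.\<close>

lemma extreme_points_simplex: "extreme_points (std_simplex d) = unit_vec d ` {..<d}"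
proof (intro equalityI subsetI)
  fix x assume ext: "x \<in> extreme_points (std_simplex d)"
  then have x: "x \<in> std_simplex d" by (simp add: extreme_points_def)
  have "\<exists>i<d. x $ i \<noteq> 0"
    using x by (force simp: mem_std_simplex intro: ccontr sum.neutral)
  then obtain i where i: "i < d" "0 < x $ i" using x by (force simp: mem_std_simplex)
  have "x $ j = 0" if j: "j < d" "j \<noteq> i" for j
  proof (rule ccontr)
    assume "x $ j \<noteq> 0"
    with x j have xj: "0 < x $ j" by (force simp: mem_std_simplex)
    define r where "r = min (x $ i) (x $ j)"
    define w :: "real \<Rightarrow> rvec" where
      "w = (\<lambda>a. Matrix.vec d (\<lambda>k. x $ k + (if k = i then a else if k = j then - a else 0)))"
    have w: "w a \<in> std_simplex d" if "\<bar>a\<bar> \<le> r" for a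
    proof -
      have "(\<Sum>k<d. if k = i then a else if k = j then - a else 0) =
          (\<Sum>k<d. (if k = i then a else 0) + (if k = j then - a else 0))"
        using j by (intro sum.cong) auto
      also have "\<dots> = 0" using i j by (simp add: sum.distrib)
      finally show ?thesis
        using x that i j unfolding mem_std_simplex by (auto simp: w_def r_def sum.distrib)
    qed
    have "w r \<noteq> w (- r)"
      using i j xj by (auto simp: w_def vec_eq_iff r_def intro!: exI[of _ i])
    moreover have "x = (1 - 1/2) \<cdot>\<^sub>v w r + (1/2) \<cdot>\<^sub>v w (- r)"
      using x by (intro eq_vecI) (auto simp: w_def mem_std_simplex field_simps)
    moreover have "w r \<in> std_simplex d" "w (- r) \<in> std_simplex d" using i xj by (auto intro!: w simp: r_def)
    ultimately have mid: "w r \<noteq> w (- r) \<and> 0 < (1/2 :: real) \<and> (1/2 :: real) < 1 \<and>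
        x = (1 - 1/2) \<cdot>\<^sub>v w r + (1/2) \<cdot>\<^sub>v w (- r)" and w_mem: "w r \<in> std_simplex d" "w (- r) \<in> std_simplex d"
      by simp_all
    have "\<exists>u\<in>std_simplex d. \<exists>v\<in>std_simplex d. \<exists>t. u \<noteq> v \<and> 0 < t \<and> t < 1 \<and>
        x = (1 - t) \<cdot>\<^sub>v u + t \<cdot>\<^sub>v v"
      by (rule bexI[of _ "w r"], rule bexI[of _ "w (- r)"], rule exI[of _ "1/2"], rule mid)
        (fact w_mem)+
    moreover have "\<not> (\<exists>u\<in>std_simplex d. \<exists>v\<in>std_simplex d. \<exists>t. u \<noteq> v \<and> 0 < t \<and> t < 1 \<and>
        x = (1 - t) \<cdot>\<^sub>v u + t \<cdot>\<^sub>v v)"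
      using ext unfolding extreme_points_def mem_Collect_eq by (rule conjunct2)
    ultimately show False by (rule notE[rotated])
  qed
  with x i show "x \<in> unit_vec d ` {..<d}" by (auto intro: simplex_one_coordinate)
qed (auto intro: unit_vec_extreme)

lemma nondegenerate_simplex: "nondegenerate (simplex_mat d) simplex_rhs"
proof -
  have "{i. i < d \<and> 0 < (unit_vec d k :: rvec) $ i} = {k}" if "k < d" for k
    using that by (auto split: if_splits)
  then show ?thesis by (auto simp: nondegenerate_def extreme_points_simplex)
qed

lemma full_row_rank_simplex:
  assumes "0 < d"
  shows "full_row_rank (simplex_mat d)"
proof -
  interpret V: vec_space "TYPE(real)" d .
  let ?T = "transpose_mat (simplex_mat d)"
  let ?v = "Matrix.vec d (\<lambda>_. 1) :: rvec"
  have cols: "set (cols ?T) = {?v}"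
    by (simp add: cols_def simplex_mat_def vec_eq_iff)
  have "?v \<noteq> 0\<^sub>v d" using assms by (auto simp: vec_eq_iff)
  then have "V.lin_indpt {?v}"
    using assms by (intro V.finite_lin_indpt2) (auto simp: V.lincomb_def vec_eq_iff)
  then have "maximal {?v} (\<lambda>T. T \<subseteq> set (cols ?T) \<and> V.lin_indpt T)"
    unfolding cols by (auto simp: maximal_def)
  moreover have "?T \<in> carrier_mat d 1" by (simp add: simplex_mat_def)
  ultimately have "V.rank ?T = card {?v}" by (intro V.rank_card_indpt)
  then show ?thesis by (simp add: full_row_rank_def)
qed

lemma submatrix_simplex:
  assumes "i < d"
  shows "submatrix (simplex_mat d) UNIV {i} = 1\<^sub>m 1"
proof -
  have "{j. j < d \<and> j = i} = {i}" using assms by auto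
  moreover have "pick {i} 0 = i" by (simp add: Least_equality)
  ultimately show ?thesis
    using assms by (intro eq_matI) (auto simp: submatrix_def simplex_mat_def pick_UNIV)
qed

lemma basis_inverse_simplex:
  assumes "i < d"
  shows "basis_inverse (simplex_mat d) {i} = 1\<^sub>m 1"
proof -
  have inv: "mat_inverse (1\<^sub>m 1 :: rmat) \<noteq> None"
  proof
    assume "mat_inverse (1\<^sub>m 1 :: rmat) = None"
    from mat_inverse(1)[OF one_carrier_mat this] show False
      by (auto simp: ring_mat_def Units_def)
  qed
  then obtain B where B: "mat_inverse (1\<^sub>m 1 :: rmat) = Some B" by auto
  from mat_inverse(2)[OF one_carrier_mat B] have "B = 1\<^sub>m 1" by auto
  with B show ?thesis by (simp add: basis_inverse_def submatrix_simplex[OF assms])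
qed

lemma is_basis_simplex: "is_basis (simplex_mat d) B \<Longrightarrow> \<exists>i<d. B = {i}"
  by (auto simp: is_basis_def card_1_singleton_iff)

lemma basic_point_simplex:
  assumes "i < d"
  shows "basic_point (simplex_mat d) simplex_rhs {i} = unit_vec d i"
  using assms
  by (auto simp: basic_point_def basis_inverse_simplex simplex_rhs_def pos_in_def vec_eq_iff
      intro!: eq_vecI)

definition edge :: "nat \<Rightarrow> nat \<Rightarrow> rvec" where
  "edge d j = unit_vec d j - unit_vec d 0"

text \<open>The basis matrix of a single index is the 1-by-1 identity, so entering \<open>j\<close> at vertex 0 moves mass from
  index 0 to index \<open>j\<close>.\<close>

lemma edge_dir_simplex:
  assumes "0 < d" "j \<in> nonbasis (simplex_mat d) {0}"
  shows "edge_dir (simplex_mat d) {0} j = edge d j"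
  using assms
  by (intro eq_vecI) (auto simp: edge_dir_def basis_inverse_simplex edge_def pos_in_def nonbasis_def
     col_simplex_mat)

lemma edge_scalar_prod:
  assumes "c \<in> carrier_vec d" "0 < d" "j < d"
  shows "c \<bullet> edge d j = c $ j - c $ 0" "edge d j \<bullet> c = c $ j - c $ 0"
proof -
  show 1: "c \<bullet> edge d j = c $ j - c $ 0"
    using assms by (simp add: edge_def scalar_prod_minus_distrib[of _ d])
  then show "edge d j \<bullet> c = c $ j - c $ 0"
    using assms by (subst comm_scalar_prod[of _ d]) (auto simp: edge_def)
qed

lemma edge_index: "i < d \<Longrightarrow> 0 < j \<Longrightarrow> j < d \<Longrightarrow> edge d j $ i = (if i = j then 1 else if i = 0 then - 1 else 0)"
  by (auto simp: edge_def)

lemma edge_carrier [simp]: "edge d j \<in> carrier_vec d"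
  by (simp add: edge_def)

lemma edge_inj: "inj_on (edge d) {1..<d}"
proof (rule inj_onI)
  fix i j assume "i \<in> {1..<d}" "j \<in> {1..<d}" "edge d i = edge d j"
  then have "edge d j $ i = 1" using edge_index[of i d i] by simp
  with \<open>i \<in> _\<close> \<open>j \<in> _\<close> show "i = j" by (simp add: edge_index split: if_splits)
qed

text \<open>The edge directions at vertex 0 form a basis of the hyperplane of vectors with entries summing to
  zero: the coordinates of such a vector other than the one at 0 are its coefficients.\<close>

lemma span_dim_zero_sum:
  assumes "0 < d" and fin: "finite S"
    and S: "\<And>w. w \<in> S \<Longrightarrow> w \<in> carrier_vec d \<and> (\<Sum>i<d. w $ i) = 0"
    and edges: "edge d ` {1..<d} \<subseteq> S"
  shows "span_dim d S = d - 1"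
proof -
  interpret V: vec_space "TYPE(real)" d .
  let ?U = "edge d ` {1..<d}"
  have U: "?U \<subseteq> carrier_vec d" by auto
  have dim: "dim_vec (V.lincomb a ?U) = d" for a
    by (rule carrier_vecD, rule V.lincomb_closed[OF U])
  have index: "V.lincomb a ?U $ i = (\<Sum>j = 1..<d. a (edge d j) * edge d j $ i)" if "i < d" for a i
    unfolding V.lincomb_index[OF that U] by (subst sum.reindex[OF edge_inj]) (simp add: o_def)
  have index': "V.lincomb a ?U $ i = a (edge d i)" if "0 < i" "i < d" for a i
  proof -
    have "V.lincomb a ?U $ i = (\<Sum>j = 1..<d. if j = i then a (edge d j) else 0)"
      unfolding index[OF that(2)] using that by (intro sum.cong) (auto simp: edge_index)
    then show ?thesis using that by simp
  qed
  have indpt: "V.lin_indpt ?U"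
  proof (rule V.finite_lin_indpt2)
    fix a assume "V.lincomb a ?U = 0\<^sub>v d"
    then show "\<forall>v\<in>?U. a v = 0" using index'[of _ a] by auto
  qed auto
  have sumsplit: "(\<Sum>i<d. f i) = f 0 + (\<Sum>i = 1..<d. f i)" for f :: "nat \<Rightarrow> real"
    using \<open>0 < d\<close> by (simp add: lessThan_atLeast0 sum.atLeast_Suc_lessThan)
  have span: "w \<in> V.span ?U" if "w \<in> S" for w
  proof (rule V.in_spanI)
    \<comment> \<open>on an edge direction, this linear form is the coefficient \<open>w $ j\<close>\<close>
    define a where "a x = (\<Sum>i = 1..<d. w $ i * x $ i)" for x :: rvec
    have a: "a (edge d j) = w $ j" if "1 \<le> j" "j < d" for j
    proof -
      have "a (edge d j) = (\<Sum>i = 1..<d. if i = j then w $ i else 0)"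
        unfolding a_def using that by (intro sum.cong) (auto simp: edge_index)
      then show ?thesis using that by simp
    qed
    show "w = V.lincomb a ?U"
    proof (rule eq_vecI)
      fix i assume "i < dim_vec (V.lincomb a ?U)"
      then have i: "i < d" unfolding dim .
      show "w $ i = V.lincomb a ?U $ i"
      proof (cases "i = 0")
        case True
        have "V.lincomb a ?U $ 0 = (\<Sum>j = 1..<d. - w $ j)"
          unfolding index[OF \<open>0 < d\<close>] by (intro sum.cong) (auto simp: edge_index a)
        then show ?thesis using S[OF that] True by (simp add: sumsplit sum_negf)
      next
        case False
        then show ?thesis using i index' a by simp
      qed
    qed (use S[OF that] in \<open>auto simp only: dim dest: carrier_vecD\<close>)
  qed auto
  have "maximal ?U (\<lambda>T. T \<subseteq> S \<and> V.lin_indpt T)"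
    unfolding maximal_def
  proof (intro conjI allI impI)
    fix T assume T: "?U \<subseteq> T \<and> T \<subseteq> S \<and> V.lin_indpt T"
    show "T = ?U"
    proof (rule ccontr)
      assume "T \<noteq> ?U"
      then obtain w where w: "w \<in> T" "w \<notin> ?U" using T by blast
      then have "w \<in> S" using T by auto
      with S[OF this] w span have "V.lin_dep (?U \<union> {w})"
        using V.lin_dep_iff_in_span[OF U indpt _ w(2)] by auto
      moreover have "?U \<union> {w} \<subseteq> T" using T w by auto
      ultimately show False using T V.subset_li_is_li by blast
    qed
  qed (use edges indpt in auto)
  from V.dim_span[OF _ fin this] S have "span_dim d S = card ?U"
    unfolding span_dim_def by auto
  then show ?thesis using card_image[OF edge_inj[of d]] by simp
qed

lemma dir_dim_simplex:
  assumes "0 < d" and all_opt: "\<And>i. i < d \<Longrightarrow> \<exists>c\<in>C. unit_vec d i \<in> argmin_set (simplex_mat d) simplex_rhs c"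
  shows "dir_dim (simplex_mat d) simplex_rhs C = d - 1"
proof -
  have "opt_vertices (simplex_mat d) simplex_rhs C = unit_vec d ` {..<d}"
    using all_opt by (auto simp: opt_vertices_def extreme_points_simplex)
  then have "dir_dim (simplex_mat d) simplex_rhs C
      = span_dim d ((\<lambda>(i, j). unit_vec d i - unit_vec d j) ` ({..<d} \<times> {..<d}))"
    unfolding dir_dim_def by (auto intro!: arg_cong[of _ _ "span_dim d"])
  also have "\<dots> = d - 1"
    using \<open>0 < d\<close> by (intro span_dim_zero_sum) (auto simp: edge_def sum_subtractf)
  finally show ?thesis .
qed

lemma mem_argmin_simplex:
  "x \<in> argmin_set (simplex_mat d) simplex_rhs c \<longleftrightarrow>
     x \<in> std_simplex d \<and> (\<forall>y\<in>std_simplex d. c \<bullet> x \<le> c \<bullet> y)"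
  by (auto simp: argmin_set_def is_arg_min_linorder)

text \<open>Over the simplex, a linear cost averages its coefficients.\<close>

lemma unit_vec_argmin_simplex:
  assumes c: "c \<in> carrier_vec d" and i: "i < d" and min: "\<And>j. j < d \<Longrightarrow> c $ i \<le> c $ j"
  shows "unit_vec d i \<in> argmin_set (simplex_mat d) simplex_rhs c"
  unfolding mem_argmin_simplex
proof (intro conjI ballI)
  fix y assume y: "y \<in> std_simplex d"
  have "c \<bullet> unit_vec d i = c $ i * (\<Sum>j<d. y $ j)"
    using y c i by (simp add: mem_std_simplex)
  also have "\<dots> \<le> (\<Sum>j<d. c $ j * y $ j)"
    unfolding sum_distrib_left using y min by (intro sum_mono mult_right_mono) (auto simp: mem_std_simplex)
  also have "\<dots> = c \<bullet> y"
    using y c by (auto simp: scalar_prod_def mem_std_simplex lessThan_atLeast0)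
  finally show "c \<bullet> unit_vec d i \<le> c \<bullet> y" .
qed (use i in \<open>simp add: unit_vec_mem_simplex\<close>)

section \<open>The uncertainty set\<close>

text \<open>Entry 1 is the key, entries \<open>2, \<dots>, s\<close> are the payloads. The slope 2 makes every payload other than
  the one addressed by an integer key at least 1. The bound -2 on the key lies strictly below the
  bound -1 that holds for the payloads, so that the key is queried before them.\<close>

definition vee_costs :: "nat \<Rightarrow> rvec set" where
  "vee_costs s = {c \<in> carrier_vec (s + 1). c $ 0 = 0 \<and> - 2 \<le> c $ 1 \<and>
     (\<forall>j\<in>{2..s}. 2 * \<bar>c $ 1 - real j\<bar> - 1 \<le> c $ j)}"

text \<open>The cost with key \<open>t\<close> and value \<open>v\<close> of the payload that the key addresses, if there is one; the value
  \<open>2 s + 4\<close> of the other payloads satisfies their constraints for every key between -2 and \<open>s + 1\<close>.\<close>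

definition cost :: "nat \<Rightarrow> real \<Rightarrow> real \<Rightarrow> rvec" where
  "cost s t v = Matrix.vec (s + 1) (\<lambda>j.
     if j = 0 then 0 else if j = 1 then t else if real j = t then v else 2 * real s + 4)"

lemma cost_carrier [simp]: "cost s t v \<in> carrier_vec (s + 1)" "cost s t v \<in> carrier_vec (Suc s)"
  by (simp_all add: cost_def)

lemma cost_index [simp]:
  assumes "1 \<le> s"
  shows "cost s t v $ 0 = 0" "cost s t v $ Suc 0 = t"
    "2 \<le> j \<Longrightarrow> j \<le> s \<Longrightarrow> cost s t v $ j = (if real j = t then v else 2 * real s + 4)"
  using assms by (auto simp: cost_def)

lemma cost_in_vee_costs:
  assumes "1 \<le> s" "- 2 \<le> t" "t \<le> real s + 1" "- 1 \<le> v"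
  shows "cost s t v \<in> vee_costs s"
proof -
  have "2 * \<bar>t - real j\<bar> - 1 \<le> cost s t v $ j" if "j \<in> {2..s}" for j
  proof -
    have "2 \<le> real j" "real j \<le> real s" using that by auto
    with assms that show ?thesis by (auto simp: abs_if)
  qed
  with assms show ?thesis by (simp add: vee_costs_def)
qed

lemma convex_vee_costs:
  assumes "1 \<le> s"
  shows "convex_vecs (vee_costs s)"
  unfolding convex_vecs_def
proof (intro ballI allI impI)
  fix u v :: rvec and t :: real
  assume u: "u \<in> vee_costs s" and v: "v \<in> vee_costs s" and t: "0 \<le> t \<and> t \<le> 1"
  have comb: "((1 - t) \<cdot>\<^sub>v u + t \<cdot>\<^sub>v v) $ i = (1 - t) * u $ i + t * v $ i" if "i \<le> s" for i
    using that u v by (auto simp: vee_costs_def)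
  have ge: "(1 - t) * a + t * b \<le> (1 - t) * a' + t * b'" if "a \<le> a'" "b \<le> b'" for a b a' b' :: real
    using that t by (intro add_mono mult_left_mono) auto
  have "- 2 \<le> (1 - t) * u $ 1 + t * v $ 1"
    using ge[of "- 2" "u $ 1" "- 2" "v $ 1"] u v by (simp add: vee_costs_def algebra_simps)
  moreover have "2 * \<bar>(1 - t) * u $ 1 + t * v $ 1 - real j\<bar> - 1 \<le> (1 - t) * u $ j + t * v $ j"
    if j: "j \<in> {2..s}" for j
  proof -
    have "(1 - t) * u $ 1 + t * v $ 1 - real j = (1 - t) * (u $ 1 - real j) + t * (v $ 1 - real j)"
      by (simp add: algebra_simps)
    also have "\<bar>\<dots>\<bar> \<le> (1 - t) * \<bar>u $ 1 - real j\<bar> + t * \<bar>v $ 1 - real j\<bar>"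
      using t by (intro order.trans[OF abs_triangle_ineq]) (simp add: abs_mult)
    finally have "2 * \<bar>(1 - t) * u $ 1 + t * v $ 1 - real j\<bar> - 1
        \<le> (1 - t) * (2 * \<bar>u $ 1 - real j\<bar> - 1) + t * (2 * \<bar>v $ 1 - real j\<bar> - 1)"
      by (simp add: algebra_simps)
    also have "\<dots> \<le> (1 - t) * u $ j + t * v $ j"
      using u v j by (intro ge) (auto simp: vee_costs_def)
    finally show ?thesis .
  qed
  ultimately show "(1 - t) \<cdot>\<^sub>v u + t \<cdot>\<^sub>v v \<in> vee_costs s"
    using u v assms comb unfolding vee_costs_def by auto
qed

text \<open>Every vertex of the simplex is optimal for some admissible cost: \<open>e\<^sub>0\<close> for the key \<open>s + 1\<close>,
  \<open>e\<^sub>1\<close> for the key -2, and \<open>e\<^sub>i\<close> with \<open>i \<ge> 2\<close> for the key \<open>i\<close> with payload -1.\<close>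

lemma dir_dim_vee_costs:
  assumes "1 \<le> s"
  shows "dir_dim (simplex_mat (s + 1)) simplex_rhs (vee_costs s) = s"
proof -
  have "\<exists>c\<in>vee_costs s. unit_vec (s + 1) i \<in> argmin_set (simplex_mat (s + 1)) simplex_rhs c"
    if i: "i < s + 1" for i
  proof -
    define t where "t = (if i = 0 then real s + 1 else if i = 1 then - 2 else real i)"
    have "cost s t (- 1) \<in> vee_costs s"
      using assms i by (intro cost_in_vee_costs) (auto simp: t_def)
    moreover have "cost s t (- 1) $ i \<le> cost s t (- 1) $ j" if "j < s + 1" for j
      using i that by (auto simp: cost_def t_def)
    ultimately show ?thesis using i by (blast intro: unit_vec_argmin_simplex cost_carrier(1))
  qed
  then show ?thesis using dir_dim_simplex[of "s + 1"] by simp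
qed

section \<open>Sample costs and the queries that they trigger\<close>

text \<open>The key \<open>s + 1\<close> addresses no payload; it serves as the frequent cost.\<close>

abbreviation sample :: "nat \<Rightarrow> nat \<Rightarrow> rvec" where
  "sample s k \<equiv> cost s (real k) 1"

lemma observations_edge:
  assumes "c \<in> vee_costs s" "j \<in> {1..s}"
  shows "edge (s + 1) j \<bullet> c = c $ j" "c \<bullet> edge (s + 1) j = c $ j"
  using assms edge_scalar_prod[of c "s + 1" j] by (auto simp: vee_costs_def)

lemma sample_pos:
  assumes "1 \<le> s" "k \<in> {2..s + 1}" "j \<in> {1..s}"
  shows "0 < sample s k $ j"
proof (cases "j = 1")
  case True then show ?thesis using assms cost_index(2)[of s "real k" 1] by simp
next
  case False then show ?thesis using assms by auto
qed

lemma sample_in: "1 \<le> s \<Longrightarrow> k \<in> {2..s + 1} \<Longrightarrow> sample s k \<in> vee_costs s"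
  by (rule cost_in_vee_costs) auto

lemma mem_consistent_edges:
  assumes "c \<in> vee_costs s" "J \<subseteq> {1..s}"
  shows "c' \<in> consistent (vee_costs s) (edge (s + 1) ` J) (observations c) \<longleftrightarrow>
    c' \<in> vee_costs s \<and> (\<forall>j\<in>J. c' $ j = c $ j)"
proof -
  have "edge (s + 1) j \<bullet> c = c $ j" "c' \<in> vee_costs s \<Longrightarrow> edge (s + 1) j \<bullet> c' = c' $ j" if "j \<in> J" for j
    using that assms observations_edge by blast+
  then show ?thesis by (auto simp: consistent_def observations_def)
qed

text \<open>The cost with key \<open>k\<close> and payload 1 and its twin with payload -1 differ only in entry \<open>k\<close>, so queries
  of other entries do not separate them. An optimal point for the first has no mass on \<open>k\<close>, hence its
  value for the twin is nonnegative, whereas \<open>e\<^sub>k\<close> has value -1.\<close>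

lemma not_sufficient:
  assumes k: "k \<in> {2..s}" and J: "J \<subseteq> {1..s} - {k}"
  shows "\<not> pointwise_sufficient (simplex_mat (s + 1)) simplex_rhs (vee_costs s)
    (edge (s + 1) ` J) (sample s k)"
proof
  assume "pointwise_sufficient (simplex_mat (s + 1)) simplex_rhs (vee_costs s)
    (edge (s + 1) ` J) (sample s k)"
  moreover have "cost s (real k) v \<in> consistent (vee_costs s) (edge (s + 1) ` J) (observations (sample s k))"
    if "v \<in> {1, -1}" for v
  proof -
    have "cost s (real k) v \<in> vee_costs s" using k that by (intro cost_in_vee_costs) auto
    moreover have "cost s (real k) v $ j = sample s k $ j" if "j \<in> J" for j
    proof -
      have "j < s + 1" "j \<noteq> k" using that J by auto
      then show ?thesis by (simp add: cost_def)
    qed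
    moreover have "sample s k \<in> vee_costs s" using k by (intro sample_in) auto
    ultimately show ?thesis using J by (subst mem_consistent_edges) auto
  qed
  ultimately obtain x where x: "x \<in> std_simplex (s + 1)"
    and opt: "\<And>v y. v \<in> {1, -1} \<Longrightarrow> y \<in> std_simplex (s + 1) \<Longrightarrow>
       cost s (real k) v \<bullet> x \<le> cost s (real k) v \<bullet> y"
    unfolding pointwise_sufficient_def mem_argmin_simplex by blast
  have prod: "cost s (real k) v \<bullet> x = (\<Sum>j<s + 1. cost s (real k) v $ j * x $ j)" for v
    using x by (auto simp: scalar_prod_def mem_std_simplex lessThan_atLeast0)
  have "(\<Sum>j<s + 1. sample s k $ j * x $ j) \<le> 0"
    using opt[of 1 "unit_vec (s + 1) 0"] k by (simp add: prod unit_vec_mem_simplex del: sum.lessThan_Suc)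
  moreover have nonneg: "0 \<le> sample s k $ j * x $ j" if "j < s + 1" for j
  proof -
    have "0 \<le> sample s k $ j" using sample_pos[of s k j] k that by (cases "j = 0") auto
    with x that show ?thesis by (simp add: mem_std_simplex)
  qed
  moreover have "sample s k $ k * x $ k \<le> (\<Sum>j<s + 1. sample s k $ j * x $ j)"
    using nonneg k by (intro member_le_sum) auto
  ultimately have "x $ k = 0" using k nonneg[of k] by auto
  then have "cost s (real k) (- 1) $ j * x $ j = sample s k $ j * x $ j" if "j < s + 1" for j
    using k that by (auto simp: cost_def)
  then have "0 \<le> cost s (real k) (- 1) \<bullet> x"
    unfolding prod using nonneg by (intro sum_nonneg) (metis lessThan_iff)
  moreover have "cost s (real k) (- 1) \<bullet> x \<le> - 1"
    using opt[of "- 1" "unit_vec (s + 1) k"] k by (simp add: unit_vec_mem_simplex)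
  ultimately show False by simp
qed

lemma nonbasis_simplex: "nonbasis (simplex_mat (s + 1)) {0} = {1..s}"
  by (auto simp: nonbasis_def)

text \<open>A sample cost is positive except for entry 0, so \<open>e\<^sub>0\<close> is its only optimal vertex.\<close>

lemma forced_basis:
  assumes "1 \<le> s" "k \<in> {2..s + 1}"
    and "valid_choice (simplex_mat (s + 1)) simplex_rhs C (sample s k) D ch"
  shows "ch_basis ch = {0}"
proof -
  have "is_basis (simplex_mat (s + 1)) (ch_basis ch)"
    and opt: "basic_point (simplex_mat (s + 1)) simplex_rhs (ch_basis ch)
      \<in> argmin_set (simplex_mat (s + 1)) simplex_rhs (sample s k)"
    using assms(3) by (auto simp: valid_choice_def Let_def)
  then obtain i where i: "i < s + 1" "ch_basis ch = {i}" using is_basis_simplex by blast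
  with opt have "sample s k \<bullet> unit_vec (s + 1) i \<le> sample s k \<bullet> unit_vec (s + 1) 0"
    unfolding mem_argmin_simplex using unit_vec_mem_simplex[of 0 "s + 1"]
    by (metis basic_point_simplex zero_less_Suc Suc_eq_plus1)
  then have "sample s k $ i \<le> 0" using i assms(1) by simp
  with sample_pos[of s k i] assms i have "i = 0" by (cases "i = 0") auto
  with i show ?thesis by simp
qed

text \<open>As the basis is forced, validity of a choice at a sample cost can be expressed by the edges at
  vertex 0.\<close>

lemma valid_choice_simplex:
  assumes s: "1 \<le> s" and k: "k \<in> {2..s + 1}"
    and val: "valid_choice (simplex_mat (s + 1)) simplex_rhs C (sample s k) D ch"
  defines "Ck \<equiv> consistent C D (observations (sample s k))"
  shows "improvable (simplex_mat (s + 1)) C (sample s k) D ch \<longleftrightarrow>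
      min_reduced_cost Ck (edge (s + 1) (ch_j0 ch)) < 0"
    and "ch_j0 ch \<in> {1..s}"
    and "j \<in> {1..s} \<Longrightarrow>
      min_reduced_cost Ck (edge (s + 1) (ch_j0 ch)) \<le> min_reduced_cost Ck (edge (s + 1) j)"
    and "valid_out Ck (edge (s + 1) (ch_j0 ch)) (ch_out ch (ch_j0 ch))"
    and "improvable (simplex_mat (s + 1)) C (sample s k) D ch \<Longrightarrow>
      ch_jstar ch \<in> {1..s} \<and> ch_out ch (ch_j0 ch) \<bullet> edge (s + 1) (ch_jstar ch) < 0"
    and "ch_jstar ch \<in> {1..s} \<Longrightarrow>
      edge_dir (simplex_mat (s + 1)) (ch_basis ch) (ch_jstar ch) = edge (s + 1) (ch_jstar ch)"
proof -
  let ?A = "simplex_mat (s + 1)"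
  have B: "ch_basis ch = {0}" using forced_basis[OF s k val] .
  have ne: "{1..s} \<noteq> {}" using s by simp
  have \<delta>: "edge_dir ?A {0} j = edge (s + 1) j" if "j \<in> {1..s}" for j
    using that edge_dir_simplex[of "s + 1" j] unfolding nonbasis_simplex by simp
  note v = val[unfolded valid_choice_def Let_def B nonbasis_simplex, folded Ck_def]
  show j0: "ch_j0 ch \<in> {1..s}"
    using v ne by (auto simp: is_arg_min_def)
  show imp: "improvable ?A C (sample s k) D ch \<longleftrightarrow>
      min_reduced_cost Ck (edge (s + 1) (ch_j0 ch)) < 0"
    using ne by (simp only: improvable_def B nonbasis_simplex Ck_def \<delta>[OF j0] simp_thms not_False_eq_True)
  show "min_reduced_cost Ck (edge (s + 1) (ch_j0 ch)) \<le> min_reduced_cost Ck (edge (s + 1) j)"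
    if "j \<in> {1..s}"
    using v ne that \<delta>[OF j0] \<delta>[OF that] by (metis (no_types, lifting) is_arg_min_linorder)
  show "valid_out Ck (edge (s + 1) (ch_j0 ch)) (ch_out ch (ch_j0 ch))"
    using v j0 \<delta>[OF j0] by metis
  show "ch_jstar ch \<in> {1..s} \<and> ch_out ch (ch_j0 ch) \<bullet> edge (s + 1) (ch_jstar ch) < 0"
    if "improvable ?A C (sample s k) D ch"
    using v that \<delta> by (metis (no_types, lifting) is_arg_min_def)
  show "edge_dir ?A (ch_basis ch) (ch_jstar ch) = edge (s + 1) (ch_jstar ch)"
    if "ch_jstar ch \<in> {1..s}" using that B \<delta> by simp
qed

text \<open>Without data all costs are consistent. The reduced cost of the key has minimum -2, those of the
  payloads are at least -1. So the loop continues with a cost vector of key -2, for which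
  all payload bounds are positive, and only the key can enter.\<close>

lemma first_query:
  assumes s: "1 \<le> s" and k: "k \<in> {2..s + 1}"
    and val: "valid_choice (simplex_mat (s + 1)) simplex_rhs (vee_costs s) (sample s k) {} ch"
  shows "improvable (simplex_mat (s + 1)) (vee_costs s) (sample s k) {} ch" and "ch_jstar ch = 1"
proof -
  have Ck: "consistent (vee_costs s) {} (observations (sample s k)) = vee_costs s"
    by (simp add: consistent_def)
  note v = valid_choice_simplex[OF s k val, unfolded Ck]
  let ?m = "\<lambda>j. min_reduced_cost (vee_costs s) (edge (s + 1) j)"
  have low: "cost s (- 2) 1 \<in> vee_costs s" using s by (intro cost_in_vee_costs) auto
  have ge: "- 1 \<le> ?m j" if "j \<in> {2..s}" for j
    unfolding min_reduced_cost_def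
  proof (rule INF_greatest)
    fix c assume c: "c \<in> vee_costs s"
    with that have "2 * \<bar>c $ 1 - real j\<bar> - 1 \<le> c $ j" by (auto simp: vee_costs_def)
    then have "- 1 \<le> c $ j" by (simp add: abs_if split: if_splits)
    then show "- 1 \<le> ereal (c \<bullet> edge (s + 1) j)"
      using observations_edge(2)[OF c, of j] that by (simp add: one_ereal_def)
  qed
  have "?m 1 \<le> ereal (cost s (- 2) 1 \<bullet> edge (s + 1) 1)"
    unfolding min_reduced_cost_def using low by (rule INF_lower)
  also have "\<dots> = - 2" using s observations_edge(2)[OF low, of 1] by simp
  finally have m1: "?m 1 \<le> - 2" .
  have "?m (ch_j0 ch) \<le> - 2" using v(3)[of 1] m1 s by (auto intro: order.trans)
  also have "(- 2 :: ereal) < - 1" by (simp add: one_ereal_def)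
  finally have "ch_j0 ch \<notin> {2..s}" using ge[of "ch_j0 ch"] by (meson leD)
  with v(2) have j0: "ch_j0 ch = 1" by auto
  show imp: "improvable (simplex_mat (s + 1)) (vee_costs s) (sample s k) {} ch"
    unfolding v(1) using \<open>?m (ch_j0 ch) \<le> - 2\<close> by (rule order.strict_trans1) simp
  define cout where "cout = ch_out ch (ch_j0 ch)"
  have edge1: "c \<bullet> edge (s + 1) 1 = c $ 1" if "c \<in> vee_costs s" for c
    using observations_edge(2)[OF that, of 1] s by simp
  have "is_arg_min (\<lambda>c'. c' \<bullet> edge (s + 1) 1) (\<lambda>c'. c' \<in> vee_costs s) (cost s (- 2) 1)"
    unfolding is_arg_min_linorder
  proof (intro conjI allI impI low)
    fix c' assume c': "c' \<in> vee_costs s"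
    then show "cost s (- 2) 1 \<bullet> edge (s + 1) 1 \<le> c' \<bullet> edge (s + 1) 1"
      unfolding edge1[OF low] edge1[OF c'] using s by (simp add: vee_costs_def)
  qed
  then have "is_arg_min (\<lambda>c'. c' \<bullet> edge (s + 1) 1) (\<lambda>c'. c' \<in> vee_costs s) cout"
    using v(4) unfolding valid_out_def cout_def j0 by metis
  then have out: "cout \<in> vee_costs s" "cout $ 1 \<le> - 2"
    unfolding is_arg_min_linorder using low s edge1 by fastforce+
  have "ch_jstar ch \<notin> {2..s}"
  proof
    assume j: "ch_jstar ch \<in> {2..s}"
    then have "2 * \<bar>cout $ 1 - real (ch_jstar ch)\<bar> - 1 \<le> cout $ ch_jstar ch"
      using out by (auto simp: vee_costs_def)
    with out(2) j have "0 \<le> cout $ ch_jstar ch" by (simp add: abs_if split: if_splits)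
    moreover have "cout $ ch_jstar ch < 0"
      using v(5)[OF imp] observations_edge(2)[OF out(1), of "ch_jstar ch"] j by (simp add: cout_def)
    ultimately show False by simp
  qed
  with v(5)[OF imp] show "ch_jstar ch = 1" by auto
qed

text \<open>A consistent cost has the key \<open>k\<close>, so all its entries except 0 and \<open>k\<close> are at least 1, and so is
  entry \<open>k\<close> if it has been queried.\<close>

lemma later_query:
  assumes s: "1 \<le> s" and k: "k \<in> {2..s + 1}" and J: "1 \<in> J" "J \<subseteq> {1..s}"
    and val: "valid_choice (simplex_mat (s + 1)) simplex_rhs (vee_costs s) (sample s k)
      (edge (s + 1) ` J) ch"
    and imp: "improvable (simplex_mat (s + 1)) (vee_costs s) (sample s k) (edge (s + 1) ` J) ch"
  shows "ch_jstar ch = k" "k \<le> s" "k \<notin> J"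
proof -
  define Ck where "Ck = consistent (vee_costs s) (edge (s + 1) ` J) (observations (sample s k))"
  note v = valid_choice_simplex[OF s k val, folded Ck_def]
  have mem: "c \<in> Ck \<longleftrightarrow> c \<in> vee_costs s \<and> (\<forall>j\<in>J. c $ j = sample s k $ j)" for c
    unfolding Ck_def by (rule mem_consistent_edges[OF sample_in[OF s k] J(2)])
  have pos: "1 \<le> c \<bullet> edge (s + 1) j" if c: "c \<in> Ck" and j: "j \<in> {1..s}" and "j \<noteq> k \<or> k \<in> J" for c j
  proof -
    have c1: "c $ 1 = real k" using c J(1) s by (simp add: mem)
    have "1 \<le> c $ j"
    proof (cases "j = k")
      case True
      then show ?thesis using that k by (auto simp: mem)
    next
      case False
      show ?thesis
      proof (cases "j = 1")
        case True
        then show ?thesis using c1 k by simp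
      next
        case False
        then have "2 * \<bar>real k - real j\<bar> - 1 \<le> c $ j" using c j c1 by (auto simp: mem vee_costs_def)
        moreover have "1 \<le> \<bar>real k - real j\<bar>" using \<open>j \<noteq> k\<close> by (simp add: abs_if)
        ultimately show ?thesis by (simp add: abs_if split: if_splits)
      qed
    qed
    then show ?thesis using c j observations_edge(2)[of c s j] by (simp add: mem)
  qed
  have m: "0 \<le> min_reduced_cost Ck (edge (s + 1) j)" if "j \<in> {1..s}" "j \<noteq> k \<or> k \<in> J" for j
    unfolding min_reduced_cost_def using pos that by (intro INF_greatest) (force simp: one_ereal_def)
  have "min_reduced_cost Ck (edge (s + 1) (ch_j0 ch)) < 0" using imp v(1) by simp
  with m v(2) have j0: "ch_j0 ch = k" "k \<notin> J" by (force simp: not_le[symmetric])+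
  with v(2) show "k \<le> s" "k \<notin> J" by auto
  have "ch_out ch (ch_j0 ch) \<in> Ck"
    using v(4) \<open>min_reduced_cost Ck _ < 0\<close> unfolding valid_out_def is_arg_min_def by (auto split: if_splits)
  with pos v(5)[OF imp] show "ch_jstar ch = k" by fastforce
qed

text \<open>Each iteration adds one of finitely many queries, and one not asked before, so the loop ends. The
  alternative \<open>J = {} \<or> 1 \<in> J\<close> says that the key is the first entry to be queried; it is the invariant that makes the two preceding lemmas
  cover all iterations.\<close>

lemma pointwise_alg_queries:
  assumes s: "1 \<le> s" and k: "k \<in> {2..s + 1}" and J: "J \<subseteq> {1..s}" "J = {} \<or> 1 \<in> J"
    and rule: "valid_rule (simplex_mat (s + 1)) simplex_rhs (vee_costs s) \<sigma>"
  shows "\<exists>J'. pointwise_alg (simplex_mat (s + 1)) (vee_costs s) \<sigma> (sample s k) (edge (s + 1) ` J)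
      = edge (s + 1) ` J' \<and> 1 \<in> J' \<and> J' \<subseteq> J \<union> ({1, k} \<inter> {1..s})"
proof -
  let ?e = "edge (s + 1)" and ?A = "simplex_mat (s + 1)"
  let ?P = "\<lambda>D. \<exists>J'. D = ?e ` J' \<and> (J' = {} \<or> 1 \<in> J') \<and> J' \<subseteq> J \<union> ({1, k} \<inter> {1..s})"
  let ?b = "\<lambda>D. improvable ?A (vee_costs s) (sample s k) D (\<sigma> (sample s k) D)"
  let ?q = "\<lambda>D. edge_dir ?A (ch_basis (\<sigma> (sample s k) D)) (ch_jstar (\<sigma> (sample s k) D))"
  have val: "valid_choice ?A simplex_rhs (vee_costs s) (sample s k) (?e ` J') (\<sigma> (sample s k) (?e ` J'))"
    if "J' \<subseteq> {1..s}" for J'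
  proof -
    have "finite J'" using that by (rule finite_subset) simp
    then show ?thesis
      by (intro rule[unfolded valid_rule_def, rule_format] sample_in[OF s k] conjI) auto
  qed
  have step: "\<exists>i. ?q (?e ` J') = ?e i \<and> i \<in> {1, k} \<inter> {1..s} \<and> i \<notin> J' \<and> (J' = {} \<longrightarrow> i = 1)"
    if J': "J' \<subseteq> {1..s}" "J' = {} \<or> 1 \<in> J'" and imp: "?b (?e ` J')" for J'
  proof (intro exI conjI)
    let ?i = "ch_jstar (\<sigma> (sample s k) (?e ` J'))"
    note v = val[OF J'(1)]
    have i: "?i \<in> {1..s}" using valid_choice_simplex(5)[OF s k v imp] by simp
    then show "?q (?e ` J') = ?e ?i" by (rule valid_choice_simplex(6)[OF s k v])
    show "J' = {} \<longrightarrow> ?i = 1" using first_query(2)[OF s k] v by auto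
    then show "?i \<in> {1, k} \<inter> {1..s}" "?i \<notin> J'"
      using i J' later_query[OF s k _ J'(1) v imp] by auto
  qed
  have final: "1 \<in> J'" if J': "J' \<subseteq> {1..s}" "J' = {} \<or> 1 \<in> J'" and "\<not> ?b (?e ` J')" for J'
    using first_query(1)[OF s k] val[OF J'(1)] that by auto
  have inj: "inj_on ?e {1..s}"
    using edge_inj[of "s + 1"] by (simp add: atLeastLessThanSuc_atLeastAtMost)
  show ?thesis
    unfolding pointwise_alg_def
  proof (rule while_rule[where P = ?P and r = "Wellfounded.measure (\<lambda>D. card (?e ` {1..s} - D))"])
    show "?P (?e ` J)" using J by blast
  next
    fix D assume "?P D" and b: "?b D"
    then obtain J' where J': "D = ?e ` J'" "J' = {} \<or> 1 \<in> J'" "J' \<subseteq> J \<union> ({1, k} \<inter> {1..s})" by blast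
    then have sub: "J' \<subseteq> {1..s}" using J by blast
    from step[OF this J'(2)] b J'(1) obtain i where
      i: "?q D = ?e i" "i \<in> {1, k} \<inter> {1..s}" "i \<notin> J'" "J' = {} \<longrightarrow> i = 1" by blast
    show "?P (D \<union> {?q D})"
      using J' i by (intro exI[of _ "insert i J'"]) auto
    have "?e i \<notin> ?e ` J'" using inj sub i by (auto dest: inj_onD)
    then have "?e ` {1..s} - (D \<union> {?q D}) \<subset> ?e ` {1..s} - D" using i J'(1) by auto
    then show "(D \<union> {?q D}, D) \<in> Wellfounded.measure (\<lambda>D. card (?e ` {1..s} - D))"
      by (simp add: psubset_card_mono)
  next
    fix D assume "?P D" and "\<not> ?b D"
    then obtain J' where J': "D = ?e ` J'" "J' = {} \<or> 1 \<in> J'" "J' \<subseteq> J \<union> ({1, k} \<inter> {1..s})" by blast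
    then have "1 \<in> J'" using \<open>\<not> ?b D\<close> J by (intro final) auto
    with J' show "\<exists>J'. D = ?e ` J' \<and> 1 \<in> J' \<and> J' \<subseteq> J \<union> ({1, k} \<inter> {1..s})" by blast
  qed simp
qed

lemma cumulative_alg_queries:
  assumes s: "1 \<le> s" and rule: "valid_rule (simplex_mat (s + 1)) simplex_rhs (vee_costs s) \<sigma>"
    and cs: "\<And>i. i < n \<Longrightarrow> cs i \<in> sample s ` {2..s + 1}"
  shows "\<exists>J. cumulative_alg (simplex_mat (s + 1)) (vee_costs s) \<sigma> cs n = edge (s + 1) ` J \<and>
    (J = {} \<or> 1 \<in> J) \<and> J \<subseteq> insert 1 {k \<in> {2..s}. \<exists>i<n. cs i = sample s k}"
  using cs
proof (induction n)
  case 0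
  then show ?case by auto
next
  case (Suc n)
  then obtain J where J: "cumulative_alg (simplex_mat (s + 1)) (vee_costs s) \<sigma> cs n = edge (s + 1) ` J"
    "J = {} \<or> 1 \<in> J" "J \<subseteq> insert 1 {k \<in> {2..s}. \<exists>i<n. cs i = sample s k}" by force
  obtain k where k: "k \<in> {2..s + 1}" "cs n = sample s k" using Suc.prems[of n] by auto
  have "J \<subseteq> {1..s}" using J(3) s by auto
  from pointwise_alg_queries[OF s k(1) this J(2) rule] J k
  obtain J' where J': "cumulative_alg (simplex_mat (s + 1)) (vee_costs s) \<sigma> cs (Suc n) = edge (s + 1) ` J'"
    "1 \<in> J'" "J' \<subseteq> J \<union> ({1, k} \<inter> {1..s})" by auto
  have "J' \<subseteq> insert 1 {k \<in> {2..s}. \<exists>i<Suc n. cs i = sample s k}"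
    using J'(3) J(3) k by (auto simp: less_Suc_eq)
  with J' show ?case by blast
qed

section \<open>Finitely supported distributions and rare events\<close>

text \<open>Outside a finite support everything is null, and a subset of the support is measurable. Hence in the
  completion every set is measurable, and only the support counts.\<close>

lemma (in prob_space) completion_finite_support:
  assumes fin: "finite F" and single: "\<And>x. x \<in> F \<Longrightarrow> {x} \<in> sets M" and F: "prob F = 1"
    and T: "T \<subseteq> space M"
  shows "measure (completion M) T = prob (T \<inter> F)"
proof -
  have sets: "G \<in> sets M" if "G \<subseteq> F" for G
  proof (rule sets.countable)
    show "{a} \<in> sets M" if "a \<in> G" for a using that \<open>G \<subseteq> F\<close> single by blast
    show "countable G" using finite_subset[OF that fin] by (rule countable_finite)
  qed
  have null: "space M - F \<in> null_sets M"
    using F sets[of F] by (auto simp: null_sets_def emeasure_eq_measure prob_compl)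
  have "T - F \<in> null_sets (completion M)"
    using null T by (intro null_sets_completion_subset[OF _ null_sets_completionI[OF null]]) auto
  then have "measure (completion M) ((T \<inter> F) \<union> (T - F)) = measure (completion M) (T \<inter> F)"
    using sets[of "T \<inter> F"] by (intro measure_Un_null_set) auto
  moreover have "(T \<inter> F) \<union> (T - F) = T" by blast
  ultimately show ?thesis using sets[of "T \<inter> F"] by simp
qed

text \<open>Markov's inequality for the number of coordinates that fall into \<open>R\<close>, whose mean is \<open>n\<close> times the
  probability of \<open>R\<close>.\<close>

lemma (in prob_space) few_hits:
  assumes R: "R \<in> sets M" and r: "0 < r" and mean: "real n * prob R \<le> r / 2"
  defines "PM \<equiv> \<Pi>\<^sub>M i\<in>{..<n}. M"
  shows "{cs \<in> space PM. real (card {i. i < n \<and> cs i \<in> R}) < r} \<in> sets PM"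
    and "1 / 2 \<le> measure PM {cs \<in> space PM. real (card {i. i < n \<and> cs i \<in> R}) < r}"
proof -
  interpret PM: prob_space PM unfolding PM_def by (intro prob_space_PiM) (rule prob_space_axioms)
  define X :: "(nat \<Rightarrow> 'a) \<Rightarrow> real" where "X cs = (\<Sum>i<n. indicator R (cs i))" for cs
  have X: "real (card {i. i < n \<and> cs i \<in> R}) = X cs" for cs
  proof -
    have "X cs = (\<Sum>i<n. if cs i \<in> R then 1 else 0)"
      unfolding X_def by (intro sum.cong) (auto simp: indicator_def)
    also have "\<dots> = (\<Sum>i\<in>{i. i < n \<and> cs i \<in> R}. 1)" by (intro sum.mono_neutral_cong_right) auto
    finally show ?thesis by simp
  qed
  have comp: "(\<lambda>cs. cs i) \<in> PM \<rightarrow>\<^sub>M M" if "i < n" for i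
    unfolding PM_def using that by (intro measurable_component_singleton) simp
  have ind: "(\<lambda>cs. indicator R (cs i) :: real) \<in> borel_measurable PM" if "i < n" for i
    using comp[OF that] R by measurable
  have X_meas: "X \<in> borel_measurable PM"
    unfolding X_def using ind by (intro borel_measurable_sum) auto
  have int: "integrable PM (\<lambda>cs. indicator R (cs i) :: real)" if "i < n" for i
    using ind[OF that] by (intro PM.integrable_const_bound[where B = 1]) auto
  have "(\<integral>cs. indicator R (cs i) \<partial>PM) = prob R" if "i < n" for i
  proof -
    have "prob R = (\<integral>x. indicator R x \<partial>distr PM M (\<lambda>cs. cs i))"
      unfolding PM_def using that R by (subst distr_PiM_component) (auto intro: prob_space_axioms)
    also have "\<dots> = (\<integral>cs. indicator R (cs i) \<partial>PM)"
      using comp[OF that] R by (intro integral_distr) auto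
    finally show ?thesis by simp
  qed
  then have mean_X: "(\<integral>cs. X cs \<partial>PM) = real n * prob R"
    unfolding X_def using int by (subst Bochner_Integration.integral_sum) auto
  have "integrable PM X" unfolding X_def using int by (intro Bochner_Integration.integrable_sum) auto
  then have "PM.prob {cs \<in> space PM. X cs \<ge> r} \<le> (\<integral>cs. X cs \<partial>PM) / r"
  proof (rule integral_Markov_inequality_measure[where A = "{}"])
    show "AE cs in PM. 0 \<le> X cs" by (simp add: X_def sum_nonneg)
  qed (use r in auto)
  also have "\<dots> \<le> 1 / 2" using mean r by (simp add: mean_X field_simps)
  finally have "PM.prob {cs \<in> space PM. X cs \<ge> r} \<le> 1 / 2" .
  moreover have "{cs \<in> space PM. X cs < r} = space PM - {cs \<in> space PM. X cs \<ge> r}" by auto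
  moreover have "{cs \<in> space PM. X cs \<ge> r} \<in> sets PM" using X_meas by measurable
  ultimately show "1 / 2 \<le> PM.prob {cs \<in> space PM. real (card {i. i < n \<and> cs i \<in> R}) < r}"
    unfolding X by (simp add: PM.prob_compl)
  show "{cs \<in> space PM. real (card {i. i < n \<and> cs i \<in> R}) < r} \<in> sets PM"
    unfolding X using X_meas by measurable
qed

lemma space_vec_borel [simp]: "space (vec_borel d) = carrier_vec d"
  by (simp add: vec_borel_def)

lemma singleton_in_vec_borel:
  assumes "a \<in> carrier_vec d"
  shows "{a} \<in> sets (vec_borel d)"
proof -
  let ?f = "\<lambda>v :: rvec. \<lambda>i\<in>{..<d}. v $ i"
  have "?f -` (\<Pi>\<^sub>E i\<in>{..<d}. {a $ i}) \<inter> carrier_vec d \<in> sets (vec_borel d)"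
    unfolding vec_borel_def by (intro in_vimage_algebra sets_PiM_I_finite) auto
  also have "?f -` (\<Pi>\<^sub>E i\<in>{..<d}. {a $ i}) \<inter> carrier_vec d = {a}"
  proof (intro equalityI subsetI)
    fix v assume v: "v \<in> ?f -` (\<Pi>\<^sub>E i\<in>{..<d}. {a $ i}) \<inter> carrier_vec d"
    have "v $ i = a $ i" if "i < d" for i
      using PiE_mem[of "?f v" "{..<d}" "\<lambda>i. {a $ i}" i] v that by simp
    then have "v = a" using v assms by (intro eq_vecI) auto
    then show "v \<in> {a}" by simp
  qed (use assms in auto)
  finally show ?thesis .
qed

section \<open>The hard distribution and its risk\<close>

definition index_dist :: "nat \<Rightarrow> real \<Rightarrow> nat pmf" where
  "index_dist s p = bind_pmf (bernoulli_pmf p)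
     (\<lambda>rare. if rare then pmf_of_set {2..s} else return_pmf (s + 1))"

definition cost_dist :: "nat \<Rightarrow> real \<Rightarrow> rvec measure" where
  "cost_dist s p = distr (measure_pmf (index_dist s p)) (vec_borel (s + 1)) (sample s)"

lemma pmf_index_dist:
  assumes "2 \<le> s" "0 \<le> p" "p \<le> 1" "k \<in> {2..s}"
  shows "pmf (index_dist s p) k = p / (real s - 1)"
  using assms by (auto simp: index_dist_def pmf_bind pmf_of_set indicator_def of_nat_diff)

lemma set_index_dist: "2 \<le> s \<Longrightarrow> set_pmf (index_dist s p) \<subseteq> {2..s + 1}"
  by (auto simp: index_dist_def set_pmf_of_set split: if_splits)

lemma prob_space_cost_dist: "prob_space (cost_dist s p)"
  unfolding cost_dist_def by (intro prob_space.prob_space_distr measure_pmf.prob_space_axioms) simp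

lemma sets_cost_dist [simp]: "sets (cost_dist s p) = sets (vec_borel (s + 1))"
  and space_cost_dist [simp]: "space (cost_dist s p) = carrier_vec (s + 1)"
  by (simp_all add: cost_dist_def)

lemma inj_sample: "1 \<le> s \<Longrightarrow> inj (sample s)"
proof (rule injI)
  fix k l assume "1 \<le> s" "sample s k = sample s l"
  then have "sample s k $ Suc 0 = sample s l $ Suc 0" by simp
  with \<open>1 \<le> s\<close> show "k = l" by simp
qed

lemma sample_image_sets:
  assumes "finite K"
  shows "sample s ` K \<in> sets (vec_borel (s + 1))"
proof (rule sets.countable)
  show "{a} \<in> sets (vec_borel (s + 1))" if "a \<in> sample s ` K" for a
    using that by (intro singleton_in_vec_borel) auto
  show "countable (sample s ` K)" using assms by (intro countable_finite finite_imageI)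
qed

lemma measure_cost_dist:
  assumes "1 \<le> s" "finite K"
  shows "measure (cost_dist s p) (sample s ` K) = measure (index_dist s p) K"
  using assms sample_image_sets[of K s]
  by (simp add: cost_dist_def measure_distr inj_vimage_image_eq[OF inj_sample])

lemma measure_cost_dist_rare:
  assumes "2 \<le> s" "0 \<le> p" "p \<le> 1" "K \<subseteq> {2..s}"
  shows "measure (cost_dist s p) (sample s ` K) = real (card K) * (p / (real s - 1))"
proof -
  have "finite K" using assms(4) by (rule finite_subset) simp
  then have "measure (cost_dist s p) (sample s ` K) = (\<Sum>k\<in>K. pmf (index_dist s p) k)"
    using assms by (simp add: measure_cost_dist measure_measure_pmf_finite)
  also have "\<dots> = (\<Sum>k\<in>K. p / (real s - 1))"
    using assms by (intro sum.cong pmf_index_dist) auto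
  finally show ?thesis by simp
qed

lemma measure_cost_dist_support:
  assumes "2 \<le> s"
  shows "measure (cost_dist s p) (sample s ` {2..s + 1}) = 1"
  using assms set_index_dist[OF assms, of p]
  by (subst measure_cost_dist) (auto simp: measure_pmf.prob_eq_1 AE_measure_pmf_iff)

lemma distribution_on_cost_dist:
  assumes "2 \<le> s"
  shows "distribution_on (s + 1) (vee_costs s) (cost_dist s p)"
  unfolding distribution_on_def
proof (intro conjI)
  interpret prob_space "cost_dist s p" by (rule prob_space_cost_dist)
  have "AE c in cost_dist s p. c \<in> sample s ` {2..s + 1}"
    using measure_cost_dist_support[OF assms] sample_image_sets[of "{2..s + 1}" s]
    by (intro AE_prob_1) simp
  then show "AE c in cost_dist s p. c \<in> vee_costs s"
    using assms by (elim AE_mp) (auto intro!: AE_I2 sample_in)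
qed (simp_all add: prob_space_cost_dist)

text \<open>The dataset is insufficient at each rare key outside \<open>K\<close>, so the risk is at least their mass.\<close>

lemma risk_lower_bound:
  assumes s: "2 \<le> s" and p: "0 \<le> p" "p \<le> 1"
    and J: "J \<subseteq> insert 1 K" and K: "K \<subseteq> {2..s}"
  shows "(real s - 1 - real (card K)) * (p / (real s - 1))
    \<le> risk (simplex_mat (s + 1)) simplex_rhs (vee_costs s) (cost_dist s p) (edge (s + 1) ` J)"
proof -
  interpret prob_space "cost_dist s p" by (rule prob_space_cost_dist)
  let ?T = "{c \<in> vee_costs s. \<not> pointwise_sufficient (simplex_mat (s + 1)) simplex_rhs (vee_costs s)
    (edge (s + 1) ` J) c}"
  have "finite K" using K by (rule finite_subset) simp
  then have "real (card ({2..s} - K)) = real s - 1 - real (card K)"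
    using K s card_mono[OF _ K] by (simp add: card_Diff_subset of_nat_diff)
  then have "(real s - 1 - real (card K)) * (p / (real s - 1)) = prob (sample s ` ({2..s} - K))"
    using s p by (subst measure_cost_dist_rare) auto
  also have "\<dots> \<le> prob (?T \<inter> sample s ` {2..s + 1})"
  proof (rule finite_measure_mono)
    show "sample s ` ({2..s} - K) \<subseteq> ?T \<inter> sample s ` {2..s + 1}"
    proof
      fix c assume "c \<in> sample s ` ({2..s} - K)"
      then obtain k where k: "k \<in> {2..s}" "k \<notin> K" "c = sample s k" by auto
      have "insert 1 K \<subseteq> {1..s} - {k}" using K k s by auto
      with J have "J \<subseteq> {1..s} - {k}" by (rule order.trans)
      from not_sufficient[OF k(1) this] sample_in[of s k] k s
      show "c \<in> ?T \<inter> sample s ` {2..s + 1}" by auto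
    qed
    have "?T \<inter> sample s ` {2..s + 1} = sample s ` {k \<in> {2..s + 1}. sample s k \<in> ?T}" by blast
    then show "?T \<inter> sample s ` {2..s + 1} \<in> events"
      using sample_image_sets[of "{k \<in> {2..s + 1}. sample s k \<in> ?T}" s] by simp
  qed
  also have "\<dots> = measure (completion (cost_dist s p)) ?T"
    using measure_cost_dist_support[OF s, of p]
    by (intro completion_finite_support[symmetric])
       (use sample_image_sets[of "{_}" s] in \<open>auto simp: vee_costs_def\<close>)
  finally show ?thesis by (simp add: risk_def)
qed

text \<open>There are at most as many distinct rare keys among the samples as there are rare draws, so more than
  \<open>(s - 1) / 2\<close> rare keys of mass \<open>2 \<epsilon> / (s - 1)\<close> each remain unseen.\<close>

lemma cumulative_risk_lower_bound:
  assumes s: "2 \<le> s" and \<epsilon>: "0 < \<epsilon>" "2 * \<epsilon> \<le> 1"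
    and rule: "valid_rule (simplex_mat (s + 1)) simplex_rhs (vee_costs s) \<sigma>"
    and cs: "\<And>i. i < n \<Longrightarrow> cs i \<in> sample s ` {2..s + 1}"
    and few: "real (card {i. i < n \<and> cs i \<in> sample s ` {2..s}}) < (real s - 1) / 2"
  shows "\<epsilon> < risk (simplex_mat (s + 1)) simplex_rhs (vee_costs s) (cost_dist s (2 * \<epsilon>))
    (cumulative_alg (simplex_mat (s + 1)) (vee_costs s) \<sigma> cs n)"
proof -
  define K where "K = {k \<in> {2..s}. \<exists>i<n. cs i = sample s k}"
  have K_sub: "K \<subseteq> {2..s}" by (auto simp: K_def)
  have "sample s ` K \<subseteq> cs ` {i. i < n \<and> cs i \<in> sample s ` {2..s}}"
    by (force simp: K_def)
  then have "card (sample s ` K) \<le> card {i. i < n \<and> cs i \<in> sample s ` {2..s}}"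
    by (rule order.trans[OF card_mono card_image_le, rotated]) simp_all
  then have "card K \<le> card {i. i < n \<and> cs i \<in> sample s ` {2..s}}"
    using card_image[OF inj_on_subset[OF inj_sample, of s K]] s by simp
  then have "real (card K) < (real s - 1) / 2" using few by (meson of_nat_le_iff order.strict_trans1)
  then have "(real s - 1) / 2 < real s - 1 - real (card K)" by (simp add: field_simps)
  moreover have "0 < 2 * \<epsilon> / (real s - 1)" using s \<epsilon> by simp
  ultimately have "(real s - 1) / 2 * (2 * \<epsilon> / (real s - 1))
      < (real s - 1 - real (card K)) * (2 * \<epsilon> / (real s - 1))"
    by (rule mult_strict_right_mono)
  then have "\<epsilon> < (real s - 1 - real (card K)) * (2 * \<epsilon> / (real s - 1))" using s by simp
  moreover obtain J where J: "cumulative_alg (simplex_mat (s + 1)) (vee_costs s) \<sigma> cs n = edge (s + 1) ` J"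
      "J \<subseteq> insert 1 K"
    using cumulative_alg_queries[of s \<sigma> n cs, OF _ rule cs] s unfolding K_def by auto
  ultimately show ?thesis
    using risk_lower_bound[OF s _ _ J(2) K_sub, of "2 * \<epsilon>"] \<epsilon> by simp
qed

theorem theorem27:
  fixes dstar :: nat and \<epsilon> :: real
  assumes "dstar \<ge> 2" and "0 < \<epsilon>" and "\<epsilon> < 1 / 4"
  shows "\<exists>d m. \<exists>(A :: rmat) (b :: rvec) (C :: rvec set) (P :: rvec measure).
    d \<ge> dstar \<and>
    A \<in> carrier_mat m d \<and> b \<in> carrier_vec m \<and> full_row_rank A \<and>
    std_polytope A b \<noteq> {} \<and> bounded_vecs (std_polytope A b) \<and> nondegenerate A b \<and>
    C \<subseteq> carrier_vec d \<and> convex_vecs C \<and> dir_dim A b C = dstar \<and>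
    distribution_on d C P \<and>
    (\<forall>(\<sigma> :: rule) n. valid_rule A b C \<sigma> \<and> real n \<le> (real dstar - 1) / (8 * \<epsilon>) \<longrightarrow>
       measure (completion (\<Pi>\<^sub>M i\<in>{..<n}. P))
         {cs \<in> space (\<Pi>\<^sub>M i\<in>{..<n}. P). risk A b C P (cumulative_alg A C \<sigma> cs n) > \<epsilon>} \<ge> 1 / 2)"
proof -
  define s where "s = dstar"
  have s: "2 \<le> s" "1 \<le> s" using assms by (auto simp: s_def)
  let ?A = "simplex_mat (s + 1)" and ?b = simplex_rhs and ?C = "vee_costs s"
    and ?P = "cost_dist s (2 * \<epsilon>)"
  interpret P: prob_space ?P by (rule prob_space_cost_dist)
  have hard: "1 / 2 \<le> measure (completion (\<Pi>\<^sub>M i\<in>{..<n}. ?P))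
      {cs \<in> space (\<Pi>\<^sub>M i\<in>{..<n}. ?P). risk ?A ?b ?C ?P (cumulative_alg ?A ?C \<sigma> cs n) > \<epsilon>}"
    if rule: "valid_rule ?A ?b ?C \<sigma>" and n: "real n \<le> (real s - 1) / (8 * \<epsilon>)" for \<sigma> n
  proof -
    let ?PM = "\<Pi>\<^sub>M i\<in>{..<n}. ?P"
    let ?S = "sample s ` {2..s + 1}" and ?R = "sample s ` {2..s}"
    let ?F = "\<Pi>\<^sub>E i\<in>{..<n}. ?S"
    let ?T = "{cs \<in> space ?PM. risk ?A ?b ?C ?P (cumulative_alg ?A ?C \<sigma> cs n) > \<epsilon>}"
    let ?few = "{cs \<in> space ?PM. real (card {i. i < n \<and> cs i \<in> ?R}) < (real s - 1) / 2}"
    interpret PM: prob_space ?PM by (intro prob_space_PiM P.prob_space_axioms)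
    interpret finite_product_prob_space "\<lambda>_. ?P" "{..<n}" by standard simp
    have F_fin: "finite ?F" by (intro finite_PiE) auto
    have F_single: "{cs} \<in> sets ?PM" if "cs \<in> ?F" for cs
    proof -
      have "(\<Pi>\<^sub>E i\<in>{..<n}. {cs i}) \<in> sets ?PM"
      proof (rule sets_PiM_I_finite)
        fix i assume "i \<in> {..<n}"
        with that have "cs i \<in> ?S" by (rule PiE_mem)
        then have "cs i \<in> carrier_vec (s + 1)" by auto
        then show "{cs i} \<in> sets ?P" by (simp add: singleton_in_vec_borel)
      qed simp
      moreover have "(\<Pi>\<^sub>E i\<in>{..<n}. {cs i}) = {cs}"
        using that by (intro PiE_singleton) (simp add: PiE_iff)
      ultimately show ?thesis by simp
    qed
    have F_sets: "G \<in> sets ?PM" if "G \<subseteq> ?F" for G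
    proof (rule sets.countable)
      show "{cs} \<in> sets ?PM" if "cs \<in> G" for cs using \<open>G \<subseteq> ?F\<close> that F_single by blast
      show "countable G" using finite_subset[OF that F_fin] by (rule countable_finite)
    qed
    have F: "PM.prob ?F = 1"
      using sample_image_sets[of "{2..s + 1}" s] measure_cost_dist_support[OF s(1), of "2 * \<epsilon>"]
      by (subst prob_times) simp_all
    have mean: "real n * P.prob ?R \<le> (real s - 1) / 2 / 2"
    proof -
      have "P.prob ?R = 2 * \<epsilon>" using s assms by (subst measure_cost_dist_rare) (auto simp: of_nat_diff)
      moreover have "real n * (8 * \<epsilon>) \<le> real s - 1" using n assms by (simp add: field_simps)
      ultimately show ?thesis by simp
    qed
    have R_sets: "?R \<in> P.events" using sample_image_sets[of "{2..s}" s] by simp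
    have s_pos: "0 < (real s - 1) / 2" using s by simp
    have "1 / 2 \<le> PM.prob ?few" by (rule P.few_hits(2)[OF R_sets s_pos mean])
    also have "\<dots> = PM.prob (?few \<inter> ?F)"
    proof (rule PM.finite_measure_eq_AE)
      show "?few \<in> PM.events" by (rule P.few_hits(1)[OF R_sets s_pos mean])
      show "AE cs in ?PM. cs \<in> ?few \<longleftrightarrow> cs \<in> ?few \<inter> ?F"
        using PM.AE_prob_1[OF F] by (rule AE_mp) simp
      show "?few \<inter> ?F \<in> PM.events" by (rule F_sets) blast
    qed
    also have "\<dots> \<le> PM.prob (?T \<inter> ?F)"
    proof (rule PM.finite_measure_mono)
      show "?few \<inter> ?F \<subseteq> ?T \<inter> ?F"
        using cumulative_risk_lower_bound[OF s(1) _ _ rule] assms by (auto simp: PiE_iff)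
      show "?T \<inter> ?F \<in> PM.events" by (rule F_sets) blast
    qed
    also have "\<dots> = measure (completion ?PM) ?T"
      by (rule PM.completion_finite_support[OF F_fin F_single F, symmetric]) auto
    finally show ?thesis .
  qed
  show ?thesis
    unfolding s_def[symmetric]
  proof (intro exI conjI allI impI)
    show "s \<le> s + 1" "?A \<in> carrier_mat 1 (s + 1)" "?b \<in> carrier_vec 1" by (simp_all add: simplex_mat_def simplex_rhs_def)
    show "full_row_rank ?A" by (rule full_row_rank_simplex) simp
    show "std_simplex (s + 1) \<noteq> {}" using unit_vec_mem_simplex[of 0 "s + 1"] by auto
    show "bounded_vecs (std_simplex (s + 1))" by (rule bounded_simplex)
    show "nondegenerate ?A ?b" by (rule nondegenerate_simplex)
    show "?C \<subseteq> carrier_vec (s + 1)" by (auto simp: vee_costs_def)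
    show "convex_vecs ?C" using s by (intro convex_vee_costs)
    show "dir_dim ?A ?b ?C = s" using s by (intro dir_dim_vee_costs)
    show "distribution_on (s + 1) ?C ?P" using s by (intro distribution_on_cost_dist)
  qed (use hard in blast)
qed

end
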